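(* Any sample-based tester for linearity of functions $f\colon\mathbb{R}^n\to\mathbb{R}$ requires $\Omega(n)$ samples, even when the distribution $\mathcal{D}$ is the standard Gaussian $\mathcal{N}(0,I)$.
   Context: A function $f\colon\mathbb{R}^n\to\mathbb{R}$ is linear if $f(x+y)=f(x)+f(y)$ and $f(cx)=cf(x)$ for all $x,y\in\mathbb{R}^n$, $c\in\mathbb{R}$. For a distribution $\mathcal{D}$ on $\mathbb{R}^n$ and $\varepsilon>0$, a measurable $f$ is $\varepsilon$-far from linearity with respect to $\mathcal{D}$ if $\Pr_{x\sim\mathcal{D}}[f(x)\neq g(x)]>\varepsilon$ for every measurable linear $g$. A (distribution-free) tester must accept with probability at least $2/3$ when $f$ is linear and reject with probability at least $2/3$ when $f$ is $\varepsilon$-far from linear with respect to $\mathcal{D}$. A tester is sample-based if it accesses $f$ only through its values at points sampled from $\mathcal{D}$ and $\mathcal{N}(0,I)$ (it cannot choose query points). *)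

theory Defs
  imports "HOL-Probability.Probability"
begin

text \<open>
  The dimension has to be a value, because a constant independent of it is asserted. So the space
  of real vectors of dimension \<open>n\<close> is the finite product \<open>Rn n\<close> of copies of \<open>borel\<close>: its points
  are the functions \<open>nat \<Rightarrow> real\<close> that are \<open>undefined\<close> outside \<open>{..<n}\<close>. Operations on vectors
  are restricted accordingly, and functions on vectors only matter on \<open>space (Rn n)\<close>.
\<close>

definition Rn :: "nat \<Rightarrow> (nat \<Rightarrow> real) measure" where
  "Rn n = PiM {..<n} (\<lambda>_. borel)"

definition vec_add :: "nat \<Rightarrow> (nat \<Rightarrow> real) \<Rightarrow> (nat \<Rightarrow> real) \<Rightarrow> nat \<Rightarrow> real" where
  "vec_add n x y = (\<lambda>i\<in>{..<n}. x i + y i)"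

definition vec_scale :: "nat \<Rightarrow> real \<Rightarrow> (nat \<Rightarrow> real) \<Rightarrow> nat \<Rightarrow> real" where
  "vec_scale n c x = (\<lambda>i\<in>{..<n}. c * x i)"

definition linear_fun :: "nat \<Rightarrow> ((nat \<Rightarrow> real) \<Rightarrow> real) \<Rightarrow> bool" where
  "linear_fun n f \<longleftrightarrow>
     (\<forall>x\<in>space (Rn n). \<forall>y\<in>space (Rn n). f (vec_add n x y) = f x + f y) \<and>
     (\<forall>x\<in>space (Rn n). \<forall>c. f (vec_scale n c x) = c * f x)"

definition std_gaussian :: "nat \<Rightarrow> (nat \<Rightarrow> real) measure" where
  "std_gaussian n = PiM {..<n} (\<lambda>_. density lborel (\<lambda>t. ennreal (std_normal_density t)))"

text \<open>Below, a distribution \<open>D\<close> is a probability measure with \<open>sets D = sets (Rn n)\<close>.\<close>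

definition far_from_linear ::
  "nat \<Rightarrow> (nat \<Rightarrow> real) measure \<Rightarrow> real \<Rightarrow> ((nat \<Rightarrow> real) \<Rightarrow> real) \<Rightarrow> bool" where
  "far_from_linear n D \<epsilon> f \<longleftrightarrow>
     f \<in> borel_measurable (Rn n) \<and>
     (\<forall>g\<in>borel_measurable (Rn n). linear_fun n g \<longrightarrow> measure D {x \<in> space D. f x \<noteq> g x} > \<epsilon>)"

definition labelled_sample ::
  "nat \<Rightarrow> (nat \<Rightarrow> real) measure \<Rightarrow> ((nat \<Rightarrow> real) \<Rightarrow> real) \<Rightarrow> ((nat \<Rightarrow> real) \<times> real) measure" where
  "labelled_sample n D f = distr D (Rn n \<Otimes>\<^sub>M borel) (\<lambda>x. (x, f x))"

text \<open>
  A tester sees \<open>k\<close> labelled samples from \<open>D\<close> and \<open>l\<close> labelled samples from the standard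
  Gaussian, all independent.
\<close>

type_synonym samples = "(nat \<Rightarrow> (nat \<Rightarrow> real) \<times> real) \<times> (nat \<Rightarrow> (nat \<Rightarrow> real) \<times> real)"

definition sample_space :: "nat \<Rightarrow> nat \<Rightarrow> nat \<Rightarrow> samples measure" where
  "sample_space n k l =
     PiM {..<k} (\<lambda>_. Rn n \<Otimes>\<^sub>M borel) \<Otimes>\<^sub>M PiM {..<l} (\<lambda>_. Rn n \<Otimes>\<^sub>M borel)"

definition sample_distr ::
  "nat \<Rightarrow> (nat \<Rightarrow> real) measure \<Rightarrow> ((nat \<Rightarrow> real) \<Rightarrow> real) \<Rightarrow> nat \<Rightarrow> nat \<Rightarrow> samples measure" where
  "sample_distr n D f k l =
     PiM {..<k} (\<lambda>_. labelled_sample n D f) \<Otimes>\<^sub>M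
     PiM {..<l} (\<lambda>_. labelled_sample n (std_gaussian n) f)"

text \<open>
  A sample-based tester is a randomised decision rule, i.e. a Markov kernel \<open>T\<close> from the labelled
  samples to \<open>bool\<close>, where \<open>True\<close> means acceptance. The outcome of a run on \<open>f\<close> is distributed as
  \<open>sample_distr n D f k l \<bind> T\<close>. Acceptance is required of all linear functions, with no
  measurability premise, since these are continuous.
\<close>

definition sample_based_tester ::
  "nat \<Rightarrow> (nat \<Rightarrow> real) measure \<Rightarrow> real \<Rightarrow> nat \<Rightarrow> nat \<Rightarrow> (samples \<Rightarrow> bool measure) \<Rightarrow> bool" where
  "sample_based_tester n D \<epsilon> k l T \<longleftrightarrow>
     T \<in> sample_space n k l \<rightarrow>\<^sub>M prob_algebra (count_space UNIV) \<and>
     (\<forall>f. linear_fun n f \<longrightarrow> measure (sample_distr n D f k l \<bind> T) {True} \<ge> 2 / 3) \<and>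
     (\<forall>f. far_from_linear n D \<epsilon> f \<longrightarrow> measure (sample_distr n D f k l \<bind> T) {False} \<ge> 2 / 3)"

end

theory Submission
  imports Defs
begin

text \<open>
  Let \<open>m = k + l \<le> n\<close> be the number of samples. For almost every sample there is a vector \<open>b\<close>
  whose inner product with each of the \<open>m\<close> sample points is \<open>1\<close>. Hence the labels produced by the
  affine function \<open>\<langle>a, x\<rangle> + 1\<close>, which is far from linear, are exactly those produced by the linear
  function \<open>\<langle>a + b, x\<rangle>\<close>. When \<open>a\<close> is uniform in the box \<open>[0, L]\<^sup>n\<close> and \<open>L \<rightarrow> \<infinity>\<close>, the shift by
  \<open>b\<close> becomes invisible, so the average acceptance probabilities of \<open>\<langle>a, x\<rangle> + 1\<close> and of
  \<open>\<langle>a, x\<rangle>\<close> approach each other (dominated convergence over the samples). For a tester they would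
  have to be at most \<open>1/3\<close> and at least \<open>2/3\<close>.
\<close>

section \<open>Almost-everywhere statements on products with one more coordinate\<close>

text \<open>The larger product is the image of \<open>M i \<Otimes>\<^sub>M PiM I M\<close> under
  inserting the new coordinate, so an iterated statement suffices. Here the new coordinate is fixed
  first, as in the induction over the sample points.\<close>

lemma AE_PiM_insert:
  assumes "\<And>j. j \<in> insert i I \<Longrightarrow> prob_space (M j)"
    and P[measurable]: "Measurable.pred (PiM (insert i I) M) P"
    and ae: "AE x in M i. AE X in PiM I M. P (X(i := x))"
  shows "AE X in PiM (insert i I) M. P X"
proof -
  interpret Mi: prob_space "M i" using assms by auto
  interpret I: prob_space "PiM I M" using assms by (intro prob_space_PiM) auto
  interpret pair_sigma_finite "M i" "PiM I M" ..
  have "AE z in M i \<Otimes>\<^sub>M PiM I M. P ((\<lambda>(x, X). X(i := x)) z)"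
  proof (rule AE_pair_measure)
    show "AE x in M i. AE X in PiM I M. P ((\<lambda>(x, X). X(i := x)) (x, X))" using ae by simp
    show "{z \<in> space (M i \<Otimes>\<^sub>M PiM I M). P ((\<lambda>(x, X). X(i := x)) z)} \<in> sets (M i \<Otimes>\<^sub>M PiM I M)"
      by measurable
  qed
  then have "AE X in distr (M i \<Otimes>\<^sub>M PiM I M) (PiM (insert i I) M) (\<lambda>(x, X). X(i := x)). P X"
    by (subst AE_distr_iff) measurable
  moreover have "distr (M i \<Otimes>\<^sub>M PiM I M) (PiM (insert i I) M) (\<lambda>(x, X). X(i := x)) = PiM (insert i I) M"
    using assms(1) by (intro distr_pair_PiM_eq_PiM) auto
  ultimately show ?thesis by (simp only:)
qed

text \<open>The order of the two quantifiers can be exchanged because \<open>P\<close> is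
  measurable. Varying the new coordinate last suits the argument on hyperplanes, where the other
  coordinates are held fixed.\<close>

lemma AE_PiM_insert':
  assumes "\<And>j. j \<in> insert i I \<Longrightarrow> prob_space (M j)"
    and P[measurable]: "Measurable.pred (PiM (insert i I) M) P"
    and ae: "AE X in PiM I M. AE x in M i. P (X(i := x))"
  shows "AE X in PiM (insert i I) M. P X"
proof -
  interpret Mi: prob_space "M i" using assms by auto
  interpret I: prob_space "PiM I M" using assms by (intro prob_space_PiM) auto
  interpret pair_sigma_finite "M i" "PiM I M" ..
  have "AE x in M i. AE X in PiM I M. P (X(i := x))"
    using ae by (subst AE_commute) measurable
  then show ?thesis
    using assms(1) by (intro AE_PiM_insert P)
qed

section \<open>A nonzero vector orthogonal to fewer vectors than coordinates\<close>

text \<open>Elimination, by induction on \<open>S\<close>: two independent vectors orthogonal to the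
  old set have a nonzero combination that is also orthogonal to the new vector. Vanishing outside
  \<open>I\<close> lets a solution for \<open>I - {j}\<close> serve as one for
  \<open>I\<close>.\<close>

lemma orthogonal_vector_exists:
  fixes S :: "('a \<Rightarrow> real) set"
  assumes "finite S" "finite I" "card S < card I"
  shows "\<exists>u. (\<exists>i\<in>I. u i \<noteq> 0) \<and> (\<forall>i. i \<notin> I \<longrightarrow> u i = 0) \<and> (\<forall>v\<in>S. (\<Sum>i\<in>I. u i * v i) = 0)"
  using assms
proof (induction S arbitrary: I rule: finite_induct)
  case empty
  then obtain j where "j \<in> I" by fastforce
  then show ?case by (intro exI[of _ "\<lambda>i. if i = j then 1 else 0"]) auto
next
  case (insert v S)
  have sum_sub: "(\<Sum>i\<in>I. u i * w i) = (\<Sum>i\<in>I - {j}. u i * w i)" if "u j = 0" for u w :: "'a \<Rightarrow> real" and j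
    using that insert.prems by (intro sum.mono_neutral_right) auto
  \<comment> \<open>Any single coordinate can be forced to vanish, since \<open>I - {j}\<close>
    still has more elements than \<open>S\<close>.\<close>
  have sub: "\<exists>u. (\<exists>i\<in>I. u i \<noteq> 0) \<and> u j = 0 \<and> (\<forall>i. i \<notin> I \<longrightarrow> u i = 0) \<and> (\<forall>v\<in>S. (\<Sum>i\<in>I. u i * v i) = 0)"
    if "j \<in> I" for j
  proof -
    have "card S < card (I - {j})" using insert that by simp
    then obtain u where "\<exists>i\<in>I - {j}. u i \<noteq> 0" "\<forall>i. i \<notin> I - {j} \<longrightarrow> u i = 0"
      "\<forall>v\<in>S. (\<Sum>i\<in>I - {j}. u i * v i) = 0"
      using insert.IH[of "I - {j}"] insert.prems by blast
    then show ?thesis using sum_sub[of u j] by (intro exI[of _ u]) auto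
  qed
  \<comment> \<open>The choice of \<open>j\<close> is arbitrary and only yields some nonzero
    \<open>u\<close>. The second solution \<open>w\<close> is then made to vanish at a coordinate
    \<open>j'\<close> where \<open>u\<close> does not, which makes the two independent.\<close>
  obtain j where "j \<in> I" using insert.prems by fastforce
  from sub[OF this] obtain u where u: "\<exists>i\<in>I. u i \<noteq> 0" "\<forall>i. i \<notin> I \<longrightarrow> u i = 0"
      "\<forall>v\<in>S. (\<Sum>i\<in>I. u i * v i) = 0" by blast
  then obtain j' where j': "j' \<in> I" "u j' \<noteq> 0" by blast
  from sub[OF j'(1)] obtain w where w: "\<exists>i\<in>I. w i \<noteq> 0" "w j' = 0" "\<forall>i. i \<notin> I \<longrightarrow> w i = 0"
      "\<forall>v\<in>S. (\<Sum>i\<in>I. w i * v i) = 0" by blast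
  define \<alpha> \<beta> where "\<alpha> = (\<Sum>i\<in>I. u i * v i)" and "\<beta> = (\<Sum>i\<in>I. w i * v i)"
  show ?case
  proof (cases "\<beta> = 0")
    case True
    with w show ?thesis by (intro exI[of _ w]) (auto simp: \<beta>_def)
  next
    case False
    \<comment> \<open>The coefficients cancel the inner product with \<open>v\<close>. The entry at
      \<open>j'\<close> is \<open>\<beta> * u j'\<close>, hence nonzero.\<close>
    let ?z = "\<lambda>i. \<beta> * u i - \<alpha> * w i"
    have "(\<Sum>i\<in>I. ?z i * x i) = \<beta> * (\<Sum>i\<in>I. u i * x i) - \<alpha> * (\<Sum>i\<in>I. w i * x i)" for x
      by (simp add: left_diff_distrib sum_subtractf sum_distrib_left mult.assoc)
    then have "\<forall>x\<in>insert v S. (\<Sum>i\<in>I. ?z i * x i) = 0"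
      using u w by (auto simp: \<alpha>_def \<beta>_def)
    moreover have "?z j' \<noteq> 0" using False j' w by simp
    moreover have "\<forall>i. i \<notin> I \<longrightarrow> ?z i = 0" using u w by simp
    moreover have "\<exists>i\<in>I. ?z i \<noteq> 0" using j'(1) \<open>?z j' \<noteq> 0\<close> by (rule bexI[rotated])
    ultimately show ?thesis by (intro exI[of _ ?z] conjI)
  qed
qed

section \<open>The standard Gaussian: null hyperplanes and solvable systems\<close>

lemma space_Rn: "space (Rn n) = extensional {..<n}"
  by (auto simp: Rn_def space_PiM PiE_def)

lemma sets_std_gaussian [measurable_cong]: "sets (std_gaussian n) = sets (Rn n)"
  unfolding std_gaussian_def Rn_def by (intro sets_PiM_cong) auto

lemma space_std_gaussian: "space (std_gaussian n) = space (Rn n)"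
  by (rule sets_eq_imp_space_eq) (rule sets_std_gaussian)

lemma prob_space_std_gaussian: "prob_space (std_gaussian n)"
  unfolding std_gaussian_def by (intro prob_space_PiM prob_space_normal_density) auto

lemma measurable_Rn_component: "i < n \<Longrightarrow> (\<lambda>x. x i) \<in> borel_measurable (Rn n)"
  unfolding Rn_def by measurable

text \<open>If \<open>u i\<close> is nonzero, fixing all other coordinates leaves a single bad value
  for the coordinate \<open>i\<close>, and points are null for a density. If \<open>u\<close>
  vanishes, then \<open>c\<close> does not and the hyperplane is empty; this case occurs when an
  affine and a linear function have the same slope.\<close>

lemma AE_std_gaussian_hyperplane:
  assumes "(\<exists>i<n. u i \<noteq> 0) \<or> c \<noteq> 0"
  shows "AE x in std_gaussian n. (\<Sum>i<n. u i * x i) \<noteq> c"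
proof (cases "\<exists>i<n. u i \<noteq> 0")
  case False
  then have "c \<noteq> 0" using assms by blast
  then show ?thesis using False by simp
next
  case True
  then obtain i where i: "i < n" "u i \<noteq> 0" by blast
  let ?N = "density lborel (\<lambda>t. ennreal (std_normal_density t))"
  define J where "J = {..<n} - {i}"
  have J: "{..<n} = insert i J" "i \<notin> J" "finite J" using i by (auto simp: J_def)
  have "AE X in PiM (insert i J) (\<lambda>_. ?N). (\<Sum>j\<in>insert i J. u j * X j) \<noteq> c"
  proof (rule AE_PiM_insert')
    have "AE t in ?N. (\<Sum>j\<in>insert i J. u j * (X(i := t)) j) \<noteq> c" for X
    proof -
      have *: "(\<Sum>j\<in>insert i J. u j * (X(i := t)) j) = u i * t + (\<Sum>j\<in>J. u j * X j)" for t
      proof -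
        have "(\<Sum>j\<in>J. u j * (X(i := t)) j) = (\<Sum>j\<in>J. u j * X j)"
          by (rule sum.cong) (use J(2) in auto)
        then show ?thesis using J(2,3) by simp
      qed
      have "AE t in lborel. t \<noteq> (c - (\<Sum>j\<in>J. u j * X j)) / u i" by (rule AE_lborel_singleton)
      then have "AE t in lborel. (\<Sum>j\<in>insert i J. u j * (X(i := t)) j) \<noteq> c"
        unfolding * by eventually_elim (use i(2) in \<open>simp add: field_simps\<close>)
      then have "AE t in lborel. 0 < ennreal (std_normal_density t) \<longrightarrow>
          (\<Sum>j\<in>insert i J. u j * (X(i := t)) j) \<noteq> c"
        by eventually_elim blast
      then show ?thesis by (subst AE_density) auto
    qed
    then show "AE X in PiM J (\<lambda>_. ?N). AE t in ?N. (\<Sum>j\<in>insert i J. u j * (X(i := t)) j) \<noteq> c"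
      by simp
  qed (simp_all add: prob_space_normal_density)
  then show ?thesis unfolding std_gaussian_def J(1) .
qed

text \<open>
  Solvability of the system is not obviously a measurable condition on \<open>X\<close>, so the lemma passes to
  an arbitrary measurable consequence \<open>P\<close> of it; later \<open>P\<close> is the convergence of a sequence.
\<close>

lemma AE_std_gaussian_solvable:
  assumes "finite S" "finite J" "card S + card J \<le> n"
    and "\<exists>b. \<forall>v\<in>S. (\<Sum>i<n. b i * v i) = 1"
    and "Measurable.pred (PiM J (\<lambda>_. std_gaussian n)) P"
    and "\<And>X b. X \<in> space (PiM J (\<lambda>_. std_gaussian n)) \<Longrightarrow>
           \<forall>v\<in>S \<union> X ` J. (\<Sum>i<n. b i * v i) = 1 \<Longrightarrow> P X"
  shows "AE X in PiM J (\<lambda>_. std_gaussian n). P X"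
  using assms(2,1,3-)
proof (induction J arbitrary: S P rule: finite_induct)
  case empty
  then show ?case by (auto intro!: AE_I2)
next
  case (insert j J)
  have [measurable]: "Measurable.pred (PiM (insert j J) (\<lambda>_. std_gaussian n)) P" by fact
  obtain b where b: "\<forall>v\<in>S. (\<Sum>i<n. b i * v i) = 1" using insert by blast
  \<comment> \<open>Moving \<open>b\<close> along \<open>u\<close> keeps the equations for
    \<open>S\<close> intact. Such a \<open>u\<close> exists because \<open>j\<close> is still to be
    counted, so that \<open>card S < n\<close>.\<close>
  obtain u where u: "\<exists>i<n. u i \<noteq> 0" "\<forall>v\<in>S. (\<Sum>i<n. u i * v i) = 0"
    using orthogonal_vector_exists[of S "{..<n}"] insert by auto
  show ?case
  proof (rule AE_PiM_insert)
    have "AE x in std_gaussian n. (\<Sum>i<n. u i * x i) \<noteq> 0"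
      by (intro AE_std_gaussian_hyperplane) (use u in auto)
    moreover have "AE x in std_gaussian n. x \<in> space (std_gaussian n)" by (rule AE_space)
    ultimately show "AE x in std_gaussian n. AE X in PiM J (\<lambda>_. std_gaussian n). P (X(j := x))"
    proof eventually_elim
      case (elim x)
      have [measurable]: "x \<in> space (std_gaussian n)" by fact
      \<comment> \<open>The step along \<open>u\<close> that gives the new point \<open>x\<close>
        inner product 1; the denominator is nonzero for almost every \<open>x\<close>. The points of
        \<open>S\<close> need not be independent, only their system solvable.\<close>
      let ?s = "(1 - (\<Sum>i<n. b i * x i)) / (\<Sum>i<n. u i * x i)"
      show ?case
      proof (rule insert.IH[of "insert x S"])
        have *: "(\<Sum>i<n. (b i + ?s * u i) * v i) = (\<Sum>i<n. b i * v i) + ?s * (\<Sum>i<n. u i * v i)" for v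
          by (simp only: sum_distrib_left distrib_right sum.distrib mult.assoc)
        have "\<forall>v\<in>insert x S. (\<Sum>i<n. (b i + ?s * u i) * v i) = 1"
          unfolding * using elim b u by simp
        then show "\<exists>b. \<forall>v\<in>insert x S. (\<Sum>i<n. b i * v i) = 1"
          by (rule exI[where x = "\<lambda>i. b i + ?s * u i"])
        show "card (insert x S) + card J \<le> n"
          using insert.hyps insert.prems by (simp add: card_insert_if)
        show "Measurable.pred (PiM J (\<lambda>_. std_gaussian n)) (\<lambda>X. P (X(j := x)))"
          by measurable
        show "P (X(j := x))" if "X \<in> space (PiM J (\<lambda>_. std_gaussian n))"
          "\<forall>v\<in>insert x S \<union> X ` J. (\<Sum>i<n. b i * v i) = 1" for X b
          using that elim insert.hyps
          by (intro insert.prems(5)[of _ b]) (auto simp: space_PiM PiE_def extensional_def)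
      qed (use insert in simp)
    qed
  qed (use prob_space_std_gaussian in auto)
qed

section \<open>Translating the uniform distribution on a large box\<close>

lemma integral_uniform_interval:
  fixes f :: "real \<Rightarrow> real"
  assumes "L > 0" and [measurable]: "f \<in> borel_measurable borel"
  shows "(\<integral>t. f t \<partial>uniform_measure lborel {0..L}) = (\<integral>t. indicator {0..L} t * f t \<partial>lborel) / L"
proof -
  have "uniform_measure lborel {0..L} = density lborel (\<lambda>t. ennreal (indicator {0..L} t / L))"
    unfolding uniform_measure_def using assms(1)
    by (intro density_cong) (auto simp: indicator_def divide_ennreal[symmetric])
  then show ?thesis
    using assms(1) by (simp add: integral_density flip: integral_divide_zero)
qed

lemma prob_space_uniform_interval: "L > 0 \<Longrightarrow> prob_space (uniform_measure lborel {0..L::real})"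
  by (intro prob_space_uniform_measure) auto

text \<open>Up to the factor \<open>1 / L\<close>, the two integrals are those of \<open>f\<close>
  over the windows \<open>{b..L + b}\<close> and \<open>{0..L}\<close>. The windows differ within
  two intervals of length \<open>\<bar>b\<bar>\<close>, and \<open>f\<close> is at most 1
  there.\<close>

lemma uniform_interval_shift:
  fixes f :: "real \<Rightarrow> real"
  assumes L: "L > 0" and f[measurable]: "f \<in> borel_measurable borel"
    and bd: "\<And>t. 0 \<le> f t" "\<And>t. f t \<le> 1"
  shows "\<bar>(\<integral>t. f (t + b) \<partial>uniform_measure lborel {0..L}) -
          (\<integral>t. f t \<partial>uniform_measure lborel {0..L})\<bar> \<le> 2 * \<bar>b\<bar> / L"
proof -
  \<comment> \<open>\<open>?C\<close> and \<open>?D\<close> cover the symmetric difference of the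
    windows \<open>?A\<close> and \<open>?B\<close> for either sign of \<open>b\<close>, also when
    the windows are disjoint.\<close>
  let ?A = "{0..L}" and ?B = "{b..L + b}" and ?C = "{min 0 b..max 0 b}" and ?D = "{L + min 0 b..L + max 0 b}"
  have int: "integrable lborel (\<lambda>t. indicator {x..y} t * f t)" for x y
  proof (rule Bochner_Integration.integrable_bound)
    show "integrable lborel (indicator {x..y} :: real \<Rightarrow> real)"
      by (simp add: emeasure_lborel_Icc_eq)
    show "AE t in lborel. norm (indicator {x..y} t * f t) \<le> norm (indicator {x..y} t :: real)"
      using bd by (auto intro!: AE_I2 simp: indicator_def)
  qed measurable
  have intC: "integrable lborel (\<lambda>t. indicator ?C t + indicator ?D t :: real)"
    by (intro Bochner_Integration.integrable_add) (auto simp: emeasure_lborel_Icc_eq)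
  have "(\<integral>t. indicator ?A t * f (t + b) \<partial>lborel) = (\<integral>t. indicator ?B t * f t \<partial>lborel)"
    by (subst lborel_integral_real_affine[where t = b and c = 1 and f = "\<lambda>t. indicator ?B t * f t"])
       (auto simp: indicator_def add.commute intro!: Bochner_Integration.integral_cong)
  then have "\<bar>(\<integral>t. indicator ?A t * f (t + b) \<partial>lborel) - (\<integral>t. indicator ?A t * f t \<partial>lborel)\<bar> =
      \<bar>\<integral>t. indicator ?B t * f t - indicator ?A t * f t \<partial>lborel\<bar>"
    by (simp add: int)
  also have "\<dots> \<le> (\<integral>t. \<bar>indicator ?B t * f t - indicator ?A t * f t\<bar> \<partial>lborel)"
    by (rule integral_abs_bound)
  also have "\<dots> \<le> (\<integral>t. indicator ?C t + indicator ?D t \<partial>lborel)"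
  proof (rule integral_mono)
    fix t
    have "\<bar>indicator ?B t * f t - indicator ?A t * f t\<bar> = \<bar>indicator ?B t - indicator ?A t\<bar> * f t"
      using bd[of t] by (simp add: abs_mult flip: left_diff_distrib)
    also have "\<dots> \<le> \<bar>indicator ?B t - indicator ?A t\<bar>"
      using bd[of t] by (intro mult_left_le) auto
    also have "\<dots> \<le> indicator ?C t + indicator ?D t"
      by (auto simp: indicator_def min_def max_def)
    finally show "\<bar>indicator ?B t * f t - indicator ?A t * f t\<bar> \<le> indicator ?C t + indicator ?D t" .
  qed (use int intC in auto)
  also have "\<dots> = 2 * \<bar>b\<bar>"
    by (simp add: emeasure_lborel_Icc_eq min_def max_def)
  finally show ?thesis
    using L by (simp add: integral_uniform_interval divide_right_mono flip: diff_divide_distrib)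
qed

text \<open>The coordinates are shifted one at a time, and each contributes the error of the
  one-dimensional case. The bounds on \<open>f\<close> are asked on \<open>extensional J\<close>
  only, which is the space of the product.\<close>

lemma uniform_box_shift:
  fixes f :: "('a \<Rightarrow> real) \<Rightarrow> real"
  assumes L: "L > 0" and "finite J"
    and "f \<in> borel_measurable (PiM J (\<lambda>_. uniform_measure lborel {0..L}))"
    and "\<And>a. a \<in> extensional J \<Longrightarrow> 0 \<le> f a" "\<And>a. a \<in> extensional J \<Longrightarrow> f a \<le> 1"
  shows "\<bar>(\<integral>a. f (\<lambda>i\<in>J. a i + b i) \<partial>PiM J (\<lambda>_. uniform_measure lborel {0..L})) -
          (\<integral>a. f a \<partial>PiM J (\<lambda>_. uniform_measure lborel {0..L}))\<bar> \<le> (\<Sum>i\<in>J. 2 * \<bar>b i\<bar> / L)"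
  using assms(2-)
proof (induction J arbitrary: f rule: finite_induct)
  case empty
  \<comment> \<open>The product over no coordinates is a single point, and the restricted shift
    fixes it.\<close>
  have "PiM {} (\<lambda>_::'a. uniform_measure lborel {0..L}) = count_space {\<lambda>_. undefined}"
    by (simp add: PiM_empty)
  then show ?case by (simp add: lebesgue_integral_count_space_finite restrict_def)
next
  case (insert i J)
  define U where "U = uniform_measure lborel {0..L}"
  have [measurable_cong]: "sets U = sets borel" by (simp add: U_def)
  interpret U: prob_space U unfolding U_def by (rule prob_space_uniform_interval[OF L])
  interpret P: product_prob_space "\<lambda>_::'a. U" by (rule product_prob_spaceI) unfold_locales
  interpret J: prob_space "PiM J (\<lambda>_. U)" by (intro prob_space_PiM) unfold_locales
  interpret I: prob_space "PiM (insert i J) (\<lambda>_. U)" by (intro prob_space_PiM) unfold_locales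
  have f[measurable]: "f \<in> borel_measurable (PiM (insert i J) (\<lambda>_. U))"
    using insert.prems by (simp add: U_def)
  have f01: "0 \<le> f a" "f a \<le> 1" "\<bar>f a\<bar> \<le> 1" if "a \<in> extensional (insert i J)" for a
    using insert.prems that by (auto simp: abs_of_nonneg)
  have spU: "space U = UNIV" by (simp add: U_def)
  have sp: "space (PiM K (\<lambda>_. U)) = extensional K" for K :: "'a set"
    by (auto simp: space_PiM spU PiE_def)
  have ext: "a(i := t) \<in> extensional (insert i J)" if "a \<in> extensional J" for a :: "'a \<Rightarrow> real" and t
    using that by (auto simp: extensional_def)
  \<comment> \<open>\<open>g\<close> averages out the new coordinate and is again bounded by 0 and
    1, so the induction hypothesis applies to it.\<close>
  define g where "g = (\<lambda>a. \<integral>t. f (a(i := t)) \<partial>U)"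
  have g[measurable]: "g \<in> borel_measurable (PiM J (\<lambda>_. U))"
    unfolding g_def by measurable
  have g01: "0 \<le> g a \<and> g a \<le> 1" if a: "a \<in> extensional J" for a
  proof
    show "0 \<le> g a" unfolding g_def using f01 ext[OF a] by (intro Bochner_Integration.integral_nonneg) auto
    have [measurable]: "a \<in> space (PiM J (\<lambda>_. U))" using a sp by simp
    show "g a \<le> 1" unfolding g_def using f01 ext[OF a]
      by (intro U.integral_le_const U.integrable_const_bound[where B = 1] AE_I2) (auto simp: sp)
  qed
  let ?h = "\<lambda>K a. \<lambda>i\<in>K. a i + b i"
  have hext: "?h K a \<in> extensional K" for K a by simp
  have upd: "?h (insert i J) (a(i := t)) = (?h J a)(i := t + b i)" for a t
    using insert.hyps by (auto simp: fun_eq_iff restrict_def)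
  have intf: "integrable (PiM (insert i J) (\<lambda>_. U)) f"
    by (rule I.integrable_const_bound[where B = 1]) (use f01 in \<open>auto simp: abs_of_nonneg sp intro!: AE_I2\<close>)
  have [measurable]: "?h K \<in> PiM K (\<lambda>_. U) \<rightarrow>\<^sub>M PiM K (\<lambda>_. U)" for K
    by measurable
  have intfh: "integrable (PiM (insert i J) (\<lambda>_. U)) (\<lambda>a. f (?h (insert i J) a))"
    by (rule I.integrable_const_bound[where B = 1]) (use f01 in \<open>auto simp: sp abs_of_nonneg intro!: AE_I2\<close>)
  have 1: "(\<integral>a. f a \<partial>PiM (insert i J) (\<lambda>_. U)) = (\<integral>a. g a \<partial>PiM J (\<lambda>_. U))"
    unfolding g_def by (rule P.product_integral_insert) (use insert intf in auto)
  \<comment> \<open>The full shift splits in two: \<open>g'\<close> against \<open>g\<close> at the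
    shifted point moves only the coordinate \<open>i\<close>, and \<open>g\<close> at the shifted
    point against \<open>g\<close> moves only the coordinates in \<open>J\<close>.\<close>
  define g' where "g' = (\<lambda>a. \<integral>t. f ((?h J a)(i := t + b i)) \<partial>U)"
  have 2: "(\<integral>a. f (?h (insert i J) a) \<partial>PiM (insert i J) (\<lambda>_. U)) = (\<integral>a. g' a \<partial>PiM J (\<lambda>_. U))"
    unfolding g'_def upd[symmetric] by (rule P.product_integral_insert) (use insert intfh in auto)
  have g'[measurable]: "g' \<in> borel_measurable (PiM J (\<lambda>_. U))"
    unfolding g'_def by measurable
  have near: "\<bar>g' a - g (?h J a)\<bar> \<le> 2 * \<bar>b i\<bar> / L" for a
  proof -
    have [measurable]: "?h J a \<in> space (PiM J (\<lambda>_. U))" by (simp add: sp)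
    have "(\<lambda>t. f ((?h J a)(i := t))) \<in> borel_measurable U" by measurable
    then have "(\<lambda>t. f ((?h J a)(i := t))) \<in> borel_measurable borel"
      by (simp add: U_def)
    then show ?thesis
      unfolding g_def g'_def U_def
      using f01 ext[OF hext] by (intro uniform_interval_shift L) auto
  qed
  have intg: "integrable (PiM J (\<lambda>_. U)) g" "integrable (PiM J (\<lambda>_. U)) (\<lambda>a. g (?h J a))"
    by (rule J.integrable_const_bound[where B = 1];
        use g01 in \<open>auto simp: abs_of_nonneg sp intro!: AE_I2\<close>)+
  have intg': "integrable (PiM J (\<lambda>_. U)) g'"
  proof (rule J.integrable_const_bound[where B = "1 + 2 * \<bar>b i\<bar> / L"])
    have "norm (g' a) \<le> 1 + 2 * \<bar>b i\<bar> / L" for a using near[of a] g01[OF hext, of a] unfolding real_norm_def by linarith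
    then show "AE a in PiM J (\<lambda>_. U). norm (g' a) \<le> 1 + 2 * \<bar>b i\<bar> / L" by simp
  qed measurable
  have "\<bar>(\<integral>a. g' a \<partial>PiM J (\<lambda>_. U)) - (\<integral>a. g (?h J a) \<partial>PiM J (\<lambda>_. U))\<bar> =
      \<bar>\<integral>a. g' a - g (?h J a) \<partial>PiM J (\<lambda>_. U)\<bar>"
    using intg intg' by simp
  also have "\<dots> \<le> (\<integral>a. \<bar>g' a - g (?h J a)\<bar> \<partial>PiM J (\<lambda>_. U))"
    by (rule integral_abs_bound)
  also have "\<dots> \<le> 2 * \<bar>b i\<bar> / L"
    by (intro J.integral_le_const AE_I2 near) (use intg intg' in auto)
  finally have "\<bar>(\<integral>a. g' a \<partial>PiM J (\<lambda>_. U)) - (\<integral>a. g (?h J a) \<partial>PiM J (\<lambda>_. U))\<bar> \<le> 2 * \<bar>b i\<bar> / L" .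
  moreover have "\<bar>(\<integral>a. g (?h J a) \<partial>PiM J (\<lambda>_. U)) - (\<integral>a. g a \<partial>PiM J (\<lambda>_. U))\<bar> \<le> (\<Sum>j\<in>J. 2 * \<bar>b j\<bar> / L)"
    unfolding U_def by (intro insert.IH) (use g g01 in \<open>auto simp: U_def\<close>)
  ultimately show ?case
    using insert.hyps unfolding U_def[symmetric] 1 2 by simp
qed

lemma AE_pair_std_gaussian_solvable:
  assumes kl: "k + l \<le> n"
    and P[measurable]: "Measurable.pred (PiM {..<k} (\<lambda>_. std_gaussian n) \<Otimes>\<^sub>M PiM {..<l} (\<lambda>_. std_gaussian n)) P"
    and solv: "\<And>X Y b. X \<in> space (PiM {..<k} (\<lambda>_. std_gaussian n)) \<Longrightarrow>
           Y \<in> space (PiM {..<l} (\<lambda>_. std_gaussian n)) \<Longrightarrow>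
           \<forall>v\<in>X ` {..<k} \<union> Y ` {..<l}. (\<Sum>i<n. b i * v i) = 1 \<Longrightarrow> P (X, Y)"
  shows "AE Z in PiM {..<k} (\<lambda>_. std_gaussian n) \<Otimes>\<^sub>M PiM {..<l} (\<lambda>_. std_gaussian n). P Z"
proof -
  let ?K = "PiM {..<k} (\<lambda>_. std_gaussian n)" and ?L = "PiM {..<l} (\<lambda>_. std_gaussian n)"
  interpret K: prob_space ?K by (intro prob_space_PiM prob_space_std_gaussian)
  interpret L: prob_space ?L by (intro prob_space_PiM prob_space_std_gaussian)
  interpret pair_sigma_finite ?K ?L ..
  have AE_eq: "(AE Y in ?L. P (X, Y)) \<longleftrightarrow>
      emeasure ?L (Pair X -` {Z \<in> space (?K \<Otimes>\<^sub>M ?L). \<not> P Z}) = 0" if "X \<in> space ?K" for X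
  proof (rule AE_iff_measurable)
    have "{Z \<in> space (?K \<Otimes>\<^sub>M ?L). \<not> P Z} \<in> sets (?K \<Otimes>\<^sub>M ?L)" by measurable
    then show "Pair X -` {Z \<in> space (?K \<Otimes>\<^sub>M ?L). \<not> P Z} \<in> sets ?L" by (rule sets_Pair1)
  qed (use that in \<open>auto simp: space_pair_measure\<close>)
  have "{Z \<in> space (?K \<Otimes>\<^sub>M ?L). \<not> P Z} \<in> sets (?K \<Otimes>\<^sub>M ?L)" by measurable
  note [measurable] = L.measurable_emeasure_Pair[OF this]
  have "Measurable.pred ?K (\<lambda>X. emeasure ?L (Pair X -` {Z \<in> space (?K \<Otimes>\<^sub>M ?L). \<not> P Z}) = 0)"
    by measurable
  then have "Measurable.pred ?K (\<lambda>X. AE Y in ?L. P (X, Y))"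
    by (simp only: AE_eq cong: measurable_cong)
  then have "AE X in ?K. AE Y in ?L. P (X, Y)"
  proof (rule AE_std_gaussian_solvable[where S = "{}", rotated 4])
    fix X b assume X: "X \<in> space ?K" and b: "\<forall>v\<in>{} \<union> X ` {..<k}. (\<Sum>i<n. b i * v i) = 1"
    show "AE Y in ?L. P (X, Y)"
    proof (rule AE_std_gaussian_solvable[where S = "X ` {..<k}"])
      show "card (X ` {..<k}) + card {..<l} \<le> n"
        using card_image_le[of "{..<k}" X] kl by simp
      show "Measurable.pred ?L (\<lambda>Y. P (X, Y))" using X by measurable
    qed (use X b solv in auto)
  qed (use kl in auto)
  then show ?thesis by (intro AE_pair_measure) measurable
qed

definition affine_fun :: "nat \<Rightarrow> (nat \<Rightarrow> real) \<Rightarrow> real \<Rightarrow> (nat \<Rightarrow> real) \<Rightarrow> real" where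
  "affine_fun n a c x = (\<Sum>i<n. a i * x i) + c"

lemma measurable_affine_fun [measurable]: "affine_fun n a c \<in> borel_measurable (Rn n)"
  unfolding affine_fun_def by (intro borel_measurable_add borel_measurable_sum borel_measurable_times
      borel_measurable_const measurable_Rn_component) auto

lemma linear_fun_affine_fun: "linear_fun n (affine_fun n a 0)"
  by (auto simp: linear_fun_def affine_fun_def vec_add_def vec_scale_def sum.distrib sum_distrib_left
      distrib_left intro!: sum.cong)

lemma linear_fun_eq_affine_fun:
  assumes g: "linear_fun n g"
  obtains u where "\<And>x. x \<in> space (Rn n) \<Longrightarrow> g x = affine_fun n u 0 x"
proof
  define e :: "nat \<Rightarrow> nat \<Rightarrow> real" where "e = (\<lambda>i. \<lambda>j\<in>{..<n}. if j = i then 1 else 0)"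
  fix x assume x: "x \<in> space (Rn n)"
  define p where "p = (\<lambda>m. \<lambda>j\<in>{..<n}. if j < m then x j else 0)"
  have "g (p m) = (\<Sum>i<m. g (e i) * x i)" if "m \<le> n" for m
    using that
  proof (induction m)
    case 0
    have "p 0 = vec_scale n 0 (p 0)" by (auto simp: p_def vec_scale_def fun_eq_iff)
    moreover have "g (vec_scale n 0 (p 0)) = 0 * g (p 0)"
      using g by (simp add: linear_fun_def space_Rn p_def)
    ultimately show ?case by simp
  next
    case (Suc m)
    have "p (Suc m) = vec_add n (p m) (vec_scale n (x m) (e m))"
      by (auto simp: p_def vec_add_def vec_scale_def e_def fun_eq_iff less_Suc_eq)
    moreover have "g (vec_add n (p m) (vec_scale n (x m) (e m))) = g (p m) + x m * g (e m)"
    proof -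
      have "p m \<in> space (Rn n)" "e m \<in> space (Rn n)" "vec_scale n (x m) (e m) \<in> space (Rn n)"
        by (simp_all add: space_Rn p_def e_def vec_scale_def)
      then show ?thesis using g by (simp add: linear_fun_def)
    qed
    ultimately show ?case using Suc by simp
  qed
  moreover have "p n = x"
    using x by (auto simp: p_def space_Rn extensional_def fun_eq_iff)
  ultimately show "g x = affine_fun n (\<lambda>i. g (e i)) 0 x"
    by (force simp: affine_fun_def)
qed

lemma far_from_linear_affine_fun:
  assumes "\<epsilon> < 1" "c \<noteq> 0"
  shows "far_from_linear n (std_gaussian n) \<epsilon> (affine_fun n a c)"
  unfolding far_from_linear_def
proof (intro conjI ballI impI)
  fix g assume [measurable]: "g \<in> borel_measurable (Rn n)" and g: "linear_fun n g"
  interpret prob_space "std_gaussian n" by (rule prob_space_std_gaussian)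
  have ev: "{x \<in> space (std_gaussian n). affine_fun n a c x \<noteq> g x} \<in> events"
    unfolding space_std_gaussian sets_std_gaussian
    by (intro borel_measurable_neq measurable_affine_fun) fact
  obtain u where u: "\<And>x. x \<in> space (Rn n) \<Longrightarrow> g x = affine_fun n u 0 x"
    using linear_fun_eq_affine_fun[OF g] by blast
  have "AE x in std_gaussian n. (\<Sum>i<n. (u i - a i) * x i) \<noteq> c"
    by (rule AE_std_gaussian_hyperplane) (use assms in simp)
  then have "AE x in std_gaussian n. x \<in> {x \<in> space (std_gaussian n). affine_fun n a c x \<noteq> g x}"
    using AE_space
    by eventually_elim
      (auto simp: u space_std_gaussian affine_fun_def left_diff_distrib sum_subtractf)
  then have "prob {x \<in> space (std_gaussian n). affine_fun n a c x \<noteq> g x} = 1"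
    by (simp only: AE_in_set_eq_1[OF ev])
  then show "\<epsilon> < prob {x \<in> space (std_gaussian n). affine_fun n a c x \<noteq> g x}"
    using assms by simp
qed measurable

definition label_samples ::
  "nat \<Rightarrow> nat \<Rightarrow> ((nat \<Rightarrow> real) \<Rightarrow> real) \<Rightarrow> (nat \<Rightarrow> nat \<Rightarrow> real) \<times> (nat \<Rightarrow> nat \<Rightarrow> real) \<Rightarrow> samples" where
  "label_samples k l f = (\<lambda>(X, Y). (\<lambda>i\<in>{..<k}. (X i, f (X i)), \<lambda>i\<in>{..<l}. (Y i, f (Y i))))"

lemma PiM_labelled_sample:
  assumes "prob_space D" and D[measurable_cong]: "sets D = sets (Rn n)"
    and f[measurable]: "f \<in> borel_measurable (Rn n)" and "finite I"
  shows "PiM I (\<lambda>_. labelled_sample n D f) =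
    distr (PiM I (\<lambda>_. D)) (PiM I (\<lambda>_. Rn n \<Otimes>\<^sub>M borel)) (\<lambda>X. \<lambda>i\<in>I. (X i, f (X i)))"
proof -
  let ?f = "\<lambda>x. (x, f x)"
  have meas: "?f \<in> D \<rightarrow>\<^sub>M Rn n \<Otimes>\<^sub>M borel" by measurable
  interpret D: prob_space D by fact
  have S: "sets (labelled_sample n D f) = sets (Rn n \<Otimes>\<^sub>M borel)" by (simp add: labelled_sample_def)
  have "PiM I (\<lambda>_. labelled_sample n D f) = PiM I (\<lambda>_. distr D (labelled_sample n D f) ?f)"
    unfolding labelled_sample_def by (intro PiM_cong distr_cong) auto
  also have "\<dots> = distr (PiM I (\<lambda>_. D)) (PiM I (\<lambda>_. labelled_sample n D f)) (compose I ?f)"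
    by (rule distr_PiM_finite_prob_space'[symmetric])
      (auto simp: assms labelled_sample_def intro!: D.prob_space_distr)
  also have "\<dots> = distr (PiM I (\<lambda>_. D)) (PiM I (\<lambda>_. Rn n \<Otimes>\<^sub>M borel)) (\<lambda>X. \<lambda>i\<in>I. (X i, f (X i)))"
    by (intro distr_cong sets_PiM_cong) (auto simp: S compose_def)
  finally show ?thesis .
qed

lemma measurable_PiM_label:
  assumes D[measurable_cong]: "sets D = sets (Rn n)" and f[measurable]: "f \<in> borel_measurable (Rn n)"
  shows "(\<lambda>X. \<lambda>i\<in>I. (X i, f (X i))) \<in> PiM I (\<lambda>_. D) \<rightarrow>\<^sub>M PiM I (\<lambda>_. Rn n \<Otimes>\<^sub>M borel)"
  by measurable

lemma sample_distr_eq_distr: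
  assumes D: "prob_space D" "sets D = sets (Rn n)" and f: "f \<in> borel_measurable (Rn n)"
  shows "sample_distr n D f k l =
    distr (PiM {..<k} (\<lambda>_. D) \<Otimes>\<^sub>M PiM {..<l} (\<lambda>_. std_gaussian n)) (sample_space n k l) (label_samples k l f)"
proof -
  interpret L: prob_space "PiM {..<l} (\<lambda>_. std_gaussian n)"
    by (intro prob_space_PiM prob_space_std_gaussian)
  note m = measurable_PiM_label[OF D(2) f, of "{..<k}"]
    measurable_PiM_label[OF sets_std_gaussian f, of "{..<l}"]
  show ?thesis
    unfolding sample_distr_def sample_space_def label_samples_def
      PiM_labelled_sample[OF D f finite_lessThan]
      PiM_labelled_sample[OF prob_space_std_gaussian sets_std_gaussian f finite_lessThan]
    by (rule pair_measure_distr[OF m])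
      (rule prob_space_imp_sigma_finite, rule L.prob_space_distr, rule m)
qed

lemma acceptance_probability:
  assumes T: "T \<in> sample_space n k l \<rightarrow>\<^sub>M prob_algebra (count_space UNIV)"
    and D: "prob_space D" "sets D = sets (Rn n)" and f: "f \<in> borel_measurable (Rn n)"
  shows "measure (sample_distr n D f k l \<bind> T) {True} =
      (\<integral>Z. measure (T (label_samples k l f Z)) {True} \<partial>(PiM {..<k} (\<lambda>_. D) \<Otimes>\<^sub>M PiM {..<l} (\<lambda>_. std_gaussian n)))"
    and "measure (sample_distr n D f k l \<bind> T) {False} = 1 - measure (sample_distr n D f k l \<bind> T) {True}"
proof -
  let ?P = "PiM {..<k} (\<lambda>_. D) \<Otimes>\<^sub>M PiM {..<l} (\<lambda>_. std_gaussian n)"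
  interpret P: prob_space ?P
    by (intro prob_space_pair prob_space_PiM prob_space_std_gaussian D)
  have lab: "label_samples k l f \<in> ?P \<rightarrow>\<^sub>M sample_space n k l"
    using measurable_PiM_label[OF D(2) f, of "{..<k}"] measurable_PiM_label[OF sets_std_gaussian f, of "{..<l}"]
    unfolding label_samples_def sample_space_def by measurable
  let ?D = "distr ?P (sample_space n k l) (label_samples k l f)"
  note eq = sample_distr_eq_distr[OF D f, of k l]
  interpret D: prob_space ?D by (rule P.prob_space_distr[OF lab])
  have D_space: "?D \<in> space (prob_algebra (sample_space n k l))"
    by (simp add: space_prob_algebra D.prob_space_axioms)
  interpret B: prob_space "?D \<bind> T" by (rule prob_space_bind'[OF D_space T])
  have setsB: "sets (?D \<bind> T) = UNIV" using sets_bind'[OF D_space T] by simp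
  then have spaceB: "space (?D \<bind> T) = UNIV" by (metis sets_eq_imp_space_eq sets_count_space space_count_space Pow_UNIV)
  have "B.prob {False} = B.prob (space (?D \<bind> T) - {True})"
    unfolding spaceB by (rule arg_cong[where f = B.prob]) auto
  then show "measure (sample_distr n D f k l \<bind> T) {False} = 1 - measure (sample_distr n D f k l \<bind> T) {True}"
    unfolding eq by (simp add: B.prob_compl setsB)
  have T': "T \<in> ?D \<rightarrow>\<^sub>M subprob_algebra (count_space UNIV)"
    using measurable_prob_algebraD[OF T] by simp
  have Tm: "(\<lambda>s. measure (T s) {True}) \<in> borel_measurable (sample_space n k l)"
    using T by measurable
  show "measure (sample_distr n D f k l \<bind> T) {True} =
      (\<integral>Z. measure (T (label_samples k l f Z)) {True} \<partial>?P)"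
    unfolding eq using D.measure_bind[OF T', of "{True}"] integral_distr[OF lab Tm] by simp
qed

lemma affine_fun_shift:
  "(\<Sum>i<n. b i * x i) = 1 \<Longrightarrow> affine_fun n a (c + d) x = affine_fun n (\<lambda>i\<in>{..<n}. a i + d * b i) c x"
  by (simp add: affine_fun_def distrib_right sum.distrib mult.assoc flip: sum_distrib_left)

lemma measurable_label_samples_affine:
  assumes [measurable_cong]: "sets U = sets borel"
  shows "(\<lambda>z. label_samples k l (affine_fun n (fst z) c) (snd z)) \<in>
    PiM {..<n} (\<lambda>_. U) \<Otimes>\<^sub>M (PiM {..<k} (\<lambda>_. std_gaussian n) \<Otimes>\<^sub>M PiM {..<l} (\<lambda>_. std_gaussian n))
      \<rightarrow>\<^sub>M sample_space n k l" (is "_ \<in> ?M \<rightarrow>\<^sub>M _")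
proof -
  have val: "(\<lambda>z. affine_fun n (fst z) c (f z)) \<in> borel_measurable ?M"
    if f: "f \<in> ?M \<rightarrow>\<^sub>M std_gaussian n" for f
  proof -
    have f': "f \<in> ?M \<rightarrow>\<^sub>M Rn n" using f by (simp cong: measurable_cong_sets add: sets_std_gaussian)
    have "(\<lambda>z. f z i) \<in> borel_measurable ?M" if "i < n" for i
      using measurable_compose[OF f' measurable_Rn_component[OF that]] .
    then show ?thesis
      unfolding affine_fun_def by measurable
  qed
  have f1: "(\<lambda>z. fst (snd z) i) \<in> ?M \<rightarrow>\<^sub>M std_gaussian n" if "i \<in> {..<k}" for i using that by measurable
  have f2: "(\<lambda>z. snd (snd z) i) \<in> ?M \<rightarrow>\<^sub>M std_gaussian n" if "i \<in> {..<l}" for i using that by measurable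
  note Rn = measurable_cong_sets[OF refl sets_std_gaussian, of ?M n]
  show ?thesis
    unfolding label_samples_def sample_space_def case_prod_beta
    by (intro measurable_Pair measurable_restrict val f1 f2 f1[unfolded Rn] f2[unfolded Rn])
qed

lemma no_sample_based_tester:
  assumes "\<epsilon> < 1" and kl: "k + l \<le> n"
  shows "\<not> sample_based_tester n (std_gaussian n) \<epsilon> k l T"
proof
  assume tester: "sample_based_tester n (std_gaussian n) \<epsilon> k l T"
  then have T: "T \<in> sample_space n k l \<rightarrow>\<^sub>M prob_algebra (count_space UNIV)"
    by (simp add: sample_based_tester_def)
  define G where "G = std_gaussian n"
  define P where "P = PiM {..<k} (\<lambda>_. G) \<Otimes>\<^sub>M PiM {..<l} (\<lambda>_. G)"
  define t where "t = (\<lambda>a c Z. measure (T (label_samples k l (affine_fun n a c) Z)) {True})"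
  define U where "U = (\<lambda>N. uniform_measure lborel {0..real (Suc N)})"
  define A where "A = (\<lambda>N. PiM {..<n} (\<lambda>_. U N))"
  interpret P: prob_space P
    unfolding P_def G_def by (intro prob_space_pair prob_space_PiM prob_space_std_gaussian)
  have U[measurable_cong]: "sets (U N) = sets borel" for N by (simp add: U_def)
  interpret U: prob_space "U N" for N
    unfolding U_def by (rule prob_space_uniform_interval) simp
  interpret A: prob_space "A N" for N
    unfolding A_def by (intro prob_space_PiM) unfold_locales
  interpret AP: pair_prob_space "A N" P for N ..
  have spA: "space (A N) = extensional {..<n}" for N
    by (auto simp: A_def space_PiM U_def PiE_def)
  have [measurable]: "(\<lambda>s. measure (T s) {True}) \<in> borel_measurable (sample_space n k l)"
    using T by measurable
  have t_meas[measurable]: "(\<lambda>z. t (fst z) c (snd z)) \<in> borel_measurable (A N \<Otimes>\<^sub>M P)" for c N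
    unfolding t_def A_def P_def G_def using measurable_label_samples_affine[OF U, of k l n c N] by measurable
  have t01: "0 \<le> t a c Z" "t a c Z \<le> 1" "\<bar>t a c Z\<bar> \<le> 1" if "a \<in> extensional {..<n}" "Z \<in> space P" for a c Z
  proof -
    have "label_samples k l (affine_fun n a c) Z \<in> space (sample_space n k l)"
      using measurable_space[OF measurable_label_samples_affine[OF U, of k l n c 0], of "(a, Z)"] that spA[of 0]
      by (simp add: space_pair_measure A_def P_def G_def)
    then have "T (label_samples k l (affine_fun n a c) Z) \<in> space (prob_algebra (count_space UNIV))"
      using measurable_space[OF T] by blast
    then interpret R: prob_space "T (label_samples k l (affine_fun n a c) Z)"
      by (simp add: space_prob_algebra)
    show "0 \<le> t a c Z" "t a c Z \<le> 1" "\<bar>t a c Z\<bar> \<le> 1"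
      by (auto simp: t_def)
  qed
  have int: "integrable (A N \<Otimes>\<^sub>M P) (\<lambda>(a, Z). t a c Z)" for N c
    by (rule AP.integrable_const_bound[where B = 1])
      (use t_meas in \<open>auto intro!: AE_I2 t01 simp: space_pair_measure spA case_prod_beta\<close>)
  define \<Phi> where "\<Phi> = (\<lambda>N c Z. \<integral>a. t a c Z \<partial>A N)"
  have \<Phi>_meas[measurable]: "\<Phi> N c \<in> borel_measurable P" for N c
  proof -
    have "(\<lambda>z. t (snd z) c (fst z)) \<in> borel_measurable (P \<Otimes>\<^sub>M A N)"
      using measurable_compose[OF measurable_pair_swap' t_meas[of c N]] by (simp add: case_prod_beta)
    then show ?thesis unfolding \<Phi>_def
      by (intro A.borel_measurable_lebesgue_integral) (simp add: case_prod_beta)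
  qed
  have t_meas': "(\<lambda>a. t a c Z) \<in> borel_measurable (A N)" if "Z \<in> space P" for c Z N
    using measurable_compose[OF measurable_Pair2'[OF that] t_meas[of c N]] by simp
  have \<Phi>01: "0 \<le> \<Phi> N c Z" "\<Phi> N c Z \<le> 1" if "Z \<in> space P" for N c Z
  proof -
    show "0 \<le> \<Phi> N c Z" unfolding \<Phi>_def
      by (intro Bochner_Integration.integral_nonneg) (use t01 that spA in auto)
    show "\<Phi> N c Z \<le> 1" unfolding \<Phi>_def
      by (intro A.integral_le_const A.integrable_const_bound[where B = 1] AE_I2)
        (use t01 that spA t_meas' in auto)
  qed
  have \<Phi>_int: "integrable P (\<Phi> N c)" for N c
    by (rule P.integrable_const_bound[where B = 1])
      (use \<Phi>01 in \<open>auto intro!: AE_I2 simp: abs_of_nonneg\<close>)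
  have fubini: "(\<integral>Z. \<Phi> N c Z \<partial>P) = (\<integral>a. \<integral>Z. t a c Z \<partial>P \<partial>A N)" for N c
    unfolding \<Phi>_def by (rule AP.Fubini_integral[OF int])
  have inner: "integrable (A N) (\<lambda>a. \<integral>Z. t a c Z \<partial>P)" for N c
    using AP.integrable_fst'[OF int] by simp
  note acc = acceptance_probability[OF T prob_space_std_gaussian sets_std_gaussian measurable_affine_fun]
  have "(\<integral>Z. t a 0 Z \<partial>P) \<ge> 2/3" for a
  proof -
    have "measure (sample_distr n (std_gaussian n) (affine_fun n a 0) k l \<bind> T) {True} \<ge> 2/3"
      using tester linear_fun_affine_fun[of n a] unfolding sample_based_tester_def by blast
    then show ?thesis
      using acc(1)[of a 0] by (simp add: t_def P_def G_def)
  qed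
  then have lin: "(\<integral>Z. \<Phi> N 0 Z \<partial>P) \<ge> 2/3" for N
    unfolding fubini by (intro A.integral_ge_const inner AE_I2)
  have "(\<integral>Z. t a 1 Z \<partial>P) \<le> 1/3" for a
  proof -
    have "measure (sample_distr n (std_gaussian n) (affine_fun n a 1) k l \<bind> T) {False} \<ge> 2/3"
      using tester far_from_linear_affine_fun[OF \<open>\<epsilon> < 1\<close>, of 1 n a] by (simp add: sample_based_tester_def)
    then show ?thesis
      using acc[of a 1] by (simp add: t_def P_def G_def)
  qed
  then have aff: "(\<integral>Z. \<Phi> N 1 Z \<partial>P) \<le> 1/3" for N
    unfolding fubini by (intro A.integral_le_const inner AE_I2)
  have "AE Z in P. (\<lambda>N. \<Phi> N 1 Z - \<Phi> N 0 Z) \<longlonglongrightarrow> 0"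
    unfolding P_def G_def
  proof (rule AE_pair_std_gaussian_solvable[OF kl])
    show "Measurable.pred (PiM {..<k} (\<lambda>_. std_gaussian n) \<Otimes>\<^sub>M PiM {..<l} (\<lambda>_. std_gaussian n))
        (\<lambda>Z. (\<lambda>N. \<Phi> N 1 Z - \<Phi> N 0 Z) \<longlonglongrightarrow> 0)"
      unfolding G_def[symmetric] P_def[symmetric] by measurable
    fix X Y b
    assume X: "X \<in> space (PiM {..<k} (\<lambda>_. std_gaussian n))" and Y: "Y \<in> space (PiM {..<l} (\<lambda>_. std_gaussian n))"
      and b: "\<forall>v\<in>X ` {..<k} \<union> Y ` {..<l}. (\<Sum>i<n. b i * v i) = 1"
    have Z: "(X, Y) \<in> space P" using X Y by (simp add: P_def G_def space_pair_measure)
    have shift: "t a 1 (X, Y) = t (\<lambda>i\<in>{..<n}. a i + b i) 0 (X, Y)" for a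
    proof -
      have "affine_fun n a 1 v = affine_fun n (\<lambda>i\<in>{..<n}. a i + b i) 0 v" if "v \<in> X ` {..<k} \<union> Y ` {..<l}" for v
        using affine_fun_shift[where n = n and b = b and x = v and a = a and c = 0 and d = 1] b that by simp
      then have "label_samples k l (affine_fun n a 1) (X, Y) =
          label_samples k l (affine_fun n (\<lambda>i\<in>{..<n}. a i + b i) 0) (X, Y)"
        by (auto simp: label_samples_def intro!: restrict_ext)
      then show ?thesis by (simp add: t_def)
    qed
    have bound: "norm (\<Phi> N 1 (X, Y) - \<Phi> N 0 (X, Y)) \<le> (\<Sum>i<n. 2 * \<bar>b i\<bar>) / real (Suc N)" for N
      unfolding \<Phi>_def shift real_norm_def A_def U_def sum_divide_distrib
      by (rule uniform_box_shift)
        (use t_meas'[OF Z, of 0 N] t01 Z in \<open>auto simp: A_def U_def\<close>)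
    have "(\<lambda>N. (\<Sum>i<n. 2 * \<bar>b i\<bar>) / real (Suc N)) \<longlonglongrightarrow> 0"
      by (rule LIMSEQ_Suc[OF lim_const_over_n])
    then show "(\<lambda>N. \<Phi> N 1 (X, Y) - \<Phi> N 0 (X, Y)) \<longlonglongrightarrow> 0"
      by (rule Lim_null_comparison[OF always_eventually, rotated]) (use bound in blast)
  qed
  then have "(\<lambda>N. \<integral>Z. \<Phi> N 1 Z - \<Phi> N 0 Z \<partial>P) \<longlonglongrightarrow> (\<integral>Z. 0 \<partial>P)"
  proof (intro integral_dominated_convergence[where w = "\<lambda>_. 1"])
    show "AE Z in P. norm (\<Phi> N 1 Z - \<Phi> N 0 Z) \<le> 1" for N
      using \<Phi>01[of _ N 0] \<Phi>01[of _ N 1] by (intro AE_I2) (force simp: abs_le_iff)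
  qed auto
  then have "(\<lambda>N. (\<integral>Z. \<Phi> N 1 Z \<partial>P) - (\<integral>Z. \<Phi> N 0 Z \<partial>P)) \<longlonglongrightarrow> 0"
    by (simp add: \<Phi>_int)
  moreover have "(\<integral>Z. \<Phi> N 1 Z \<partial>P) - (\<integral>Z. \<Phi> N 0 Z \<partial>P) \<le> - 1/3" for N
    using lin[of N] aff[of N] by simp
  ultimately have "(0::real) \<le> - 1/3"
    by (intro LIMSEQ_le_const2) auto
  then show False by simp
qed

theorem theorem1p3:
  shows "\<exists>c::real. c > 0 \<and>
    (\<forall>(n::nat) (\<epsilon>::real) (k::nat) (l::nat) T.
       n \<ge> 1 \<longrightarrow> 0 < \<epsilon> \<longrightarrow> \<epsilon> < 1 \<longrightarrow>
       sample_based_tester n (std_gaussian n) \<epsilon> k l T \<longrightarrow>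
       real (k + l) \<ge> c * real n)"
proof (intro exI[of _ 1] conjI allI impI)
  fix n k l :: nat and \<epsilon> :: real and T
  assume "\<epsilon> < 1" "sample_based_tester n (std_gaussian n) \<epsilon> k l T"
  then have "n < k + l" using no_sample_based_tester by (meson not_le)
  then show "real (k + l) \<ge> 1 * real n" by simp
qed simp

end
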